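(* Let $0<\alpha\le1$, $\tau>0$, and let $f_0,f_1,f_2,\dots$ be real numbers. Then $$f_k\,(D^\alpha_\tau f)_k\ge\frac12(D^\alpha_\tau f^2)_k,\qquad k\ge1.$$
   Context: $\Gamma_\alpha$ is the Gamma function at $\alpha$. The sequence $\{\lambda_k\}_{k\ge1}$ is defined by $\lambda_1=1$ and $\lambda_{k+1}=\sum_{j=1}^k\big((k-j+1)^{\alpha-1}-(k-j+2)^{\alpha-1}\big)\lambda_j$ for $k\ge1$. The discrete Caputo derivative is $(D^\alpha_\tau f)_k=\Gamma_\alpha\tau^{-\alpha}\sum_{j=0}^{k-1}\lambda_{k-j}(f_{j+1}-f_j)$, $k\ge1$; $(D^\alpha_\tau f^2)_k$ is the same expression with $f_j$ replaced by $f_j^2$. *)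

theory Defs
  imports "HOL-Analysis.Analysis"
begin

text \<open>
  The sequence is indexed from 1; its value at 0 is a dummy that is never used.
\<close>

fun caputo_lambda :: "real \<Rightarrow> nat \<Rightarrow> real" where
  "caputo_lambda \<alpha> 0 = 0"
| "caputo_lambda \<alpha> (Suc k) =
     (if k = 0 then 1
      else (\<Sum>j=1..k. (real (k - j + 1) powr (\<alpha> - 1) - real (k - j + 2) powr (\<alpha> - 1))
                        * caputo_lambda \<alpha> j))"

definition discrete_caputo :: "real \<Rightarrow> real \<Rightarrow> (nat \<Rightarrow> real) \<Rightarrow> nat \<Rightarrow> real" where
  "discrete_caputo \<alpha> \<tau> f k =
     Gamma \<alpha> * \<tau> powr (- \<alpha>) * (\<Sum>j<k. caputo_lambda \<alpha> (k - j) * (f (j + 1) - f j))"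

end

theory Submission
  imports Defs
begin

text \<open>
  Expanding the squares gives
  \<open>2 f\<^sub>k (f\<^sub>j\<^sub>+\<^sub>1 - f\<^sub>j) - (f\<^sub>j\<^sub>+\<^sub>1\<^sup>2 - f\<^sub>j\<^sup>2) = g\<^sub>j - g\<^sub>j\<^sub>+\<^sub>1\<close> with
  \<open>g\<^sub>j = (f\<^sub>k - f\<^sub>j)\<^sup>2\<close>. The claim is thus that
  \<open>\<Sum>j<k. \<lambda>\<^sub>k\<^sub>-\<^sub>j (g\<^sub>j - g\<^sub>j\<^sub>+\<^sub>1)\<close> is nonnegative. As \<open>g \<ge> 0\<close> and \<open>g\<^sub>k = 0\<close>, summation
  by parts yields this as soon as the weights \<open>\<lambda>\<close> are nonnegative and nonincreasing.

  Nonnegativity is immediate from the recurrence, because \<open>m \<mapsto> m\<^sup>\<alpha>\<^sup>-\<^sup>1\<close> is nonincreasing.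
  Monotonicity is the real content. The recurrence says that the convolution of \<open>\<lambda>\<close> with the
  sequence \<open>c\<^sub>m = (m + 1)\<^sup>\<alpha>\<^sup>-\<^sup>1\<close> is constant, so the differences \<open>\<lambda>\<^sub>n\<^sub>+\<^sub>1 - \<lambda>\<^sub>n\<close> (with
  \<open>\<lambda>\<^sub>0 = 0\<close>) are the coefficients of the reciprocal of the power series \<open>\<Sum>m. c\<^sub>m x\<^sup>m\<close>.
  The sequence \<open>c\<close> is positive and log-convex, and Kaluza's theorem states that the reciprocal
  of such a series has nonpositive coefficients after the constant one.
\<close>

text \<open>
  Kaluza's theorem. Log-convexity says that the ratios \<open>r\<^sub>m = c\<^sub>m\<^sub>+\<^sub>1 / c\<^sub>m\<close> are
  nondecreasing. For \<open>m \<ge> 1\<close>, subtracting \<open>r\<^sub>m\<close> times the \<open>m\<close>-th relation from the next one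
  cancels \<open>d\<^sub>0\<close>, the only coefficient that may be positive, and expresses \<open>- c\<^sub>0 d\<^sub>m\<^sub>+\<^sub>1\<close> as the
  sum of the products of \<open>d\<^sub>i c\<^sub>m\<^sub>-\<^sub>i \<le> 0\<close> and \<open>r\<^sub>m\<^sub>-\<^sub>i - r\<^sub>m \<le> 0\<close>.
\<close>

lemma Kaluza:
  fixes c d :: "nat \<Rightarrow> real"
  assumes pos: "\<And>n. c n > 0"
    and logconvex: "\<And>n. (c (Suc n))\<^sup>2 \<le> c n * c (Suc (Suc n))"
    and d0: "d 0 \<ge> 0"
    and conv: "\<And>n. n \<ge> 1 \<Longrightarrow> (\<Sum>i\<le>n. d i * c (n - i)) = 0"
    and n: "n \<ge> 1"
  shows "d n \<le> 0"
  using n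
proof (induction n rule: less_induct)
  case (less n)
  define r where "r m = c (Suc m) / c m" for m
  have "r m \<le> r (Suc m)" for m
    using logconvex[of m] pos[of m] pos[of "Suc m"]
    by (simp add: r_def field_simps power2_eq_square)
  then have r_mono: "r l \<le> r m" if "l \<le> m" for l m
    using that by (rule lift_Suc_mono_le)
  obtain m where m: "n = Suc m"
    using less.prems by (cases n) auto
  have next_relation: "(\<Sum>i\<le>m. d i * c (Suc m - i)) + d (Suc m) * c 0 = 0"
    using conv[of "Suc m"] by simp
  have "0 \<le> (\<Sum>i\<le>m. d i * c (Suc m - i))"
  proof (cases "m = 0")
    case True
    then show ?thesis
      using d0 pos[of 1] by simp
  next
    case False
    have c_Suc: "c (Suc m - i) = c (m - i) * r (m - i)" if "i \<le> m" for i
      using that pos[of "m - i"] by (simp add: r_def Suc_diff_le)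
    have "0 \<le> (\<Sum>i\<le>m. d i * c (m - i) * (r (m - i) - r m))"
    proof (rule sum_nonneg)
      fix i assume i: "i \<in> {..m}"
      show "0 \<le> d i * c (m - i) * (r (m - i) - r m)"
      proof (cases "i = 0")
        case False
        then have "d i \<le> 0"
          using less.IH[of i] i m by auto
        then have "d i * c (m - i) \<le> 0"
          using pos[of "m - i"] by (simp add: mult_nonpos_nonneg)
        moreover have "r (m - i) - r m \<le> 0"
          using r_mono[of "m - i" m] by simp
        ultimately show ?thesis
          by (rule mult_nonpos_nonpos)
      qed simp
    qed
    also have "\<dots> = (\<Sum>i\<le>m. d i * c (Suc m - i) - d i * c (m - i) * r m)"
      by (rule sum.cong) (simp_all add: c_Suc algebra_simps)
    also have "\<dots> = (\<Sum>i\<le>m. d i * c (Suc m - i)) - (\<Sum>i\<le>m. d i * c (m - i)) * r m"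
      by (simp only: sum_subtractf sum_distrib_right)
    finally show ?thesis
      using conv[of m] False by simp
  qed
  then have "d (Suc m) * c 0 \<le> 0"
    using next_relation by simp
  then show ?case
    using pos[of 0] m by (simp add: mult_le_0_iff)
qed

lemma powr_logconvex_nat:
  fixes a :: real
  assumes "a \<le> 0"
  shows "(real (Suc n + 1) powr a)\<^sup>2 \<le> real (n + 1) powr a * real (n + 3) powr a"
proof -
  have "(real (Suc n + 1) powr a)\<^sup>2 = ((real n + 2) * (real n + 2)) powr a"
    by (simp add: power2_eq_square powr_mult add.commute)
  also have "\<dots> \<le> ((real n + 1) * (real n + 3)) powr a"
    using assms by (intro powr_mono2' mult_pos_pos) (auto simp: algebra_simps)
  also have "\<dots> = real (n + 1) powr a * real (n + 3) powr a"
    by (simp add: powr_mult add.commute)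
  finally show ?thesis .
qed

lemma caputo_lambda_nonneg:
  assumes "\<alpha> \<le> 1"
  shows "0 \<le> caputo_lambda \<alpha> n"
proof (induction n rule: less_induct)
  case (less n)
  show ?case
  proof (cases n)
    case (Suc k)
    have "0 \<le> (real (k - j + 1) powr (\<alpha> - 1) - real (k - j + 2) powr (\<alpha> - 1))
              * caputo_lambda \<alpha> j" if "j \<in> {1..k}" for j
      using assms that less.IH[of j] Suc
      by (intro mult_nonneg_nonneg) (auto intro!: powr_mono2')
    then have "0 \<le> (\<Sum>j=1..k. (real (k - j + 1) powr (\<alpha> - 1)
                              - real (k - j + 2) powr (\<alpha> - 1)) * caputo_lambda \<alpha> j)"
      by (rule sum_nonneg)
    then show ?thesis
      unfolding Suc caputo_lambda.simps by (simp only: split: if_split) simp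
  qed simp
qed

text \<open>
  This is the recurrence, rewritten to say that \<open>\<lambda>\<close> convolved with the powers \<open>(m + 1)\<^sup>\<alpha>\<^sup>-\<^sup>1\<close>
  is constant. The value \<open>\<lambda>\<^sub>0 = 0\<close> lets the difference sequence start at index 0 with
  \<open>\<lambda>\<^sub>1 - \<lambda>\<^sub>0 = 1\<close>.
\<close>

lemma caputo_lambda_diff_convolution:
  assumes "n \<ge> 1"
  shows "(\<Sum>i\<le>n. (caputo_lambda \<alpha> (Suc i) - caputo_lambda \<alpha> i)
                  * real (n - i + 1) powr (\<alpha> - 1)) = 0"
proof -
  define c where "c m = real (m + 1) powr (\<alpha> - 1)" for m
  define l where "l = caputo_lambda \<alpha>"
  have l0: "l 0 = 0"
    by (simp add: l_def)
  have drop0: "(\<Sum>j\<le>N. h j * l j) = (\<Sum>j=1..N. h j * l j)" for h :: "nat \<Rightarrow> real" and N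
    by (rule sum.mono_neutral_right) (auto simp: l0 not_le)
  have "l (Suc n) = (\<Sum>j=1..n. (c (n - j) - c (Suc n - j)) * l j)"
    using assms by (auto simp: l_def c_def Suc_diff_le intro!: sum.cong)
  also have "\<dots> = (\<Sum>j\<le>n. (c (n - j) - c (Suc n - j)) * l j)"
    by (rule drop0[symmetric])
  finally have rec: "l (Suc n) = (\<Sum>j\<le>n. c (n - j) * l j) - (\<Sum>j\<le>n. c (Suc n - j) * l j)"
    by (simp add: algebra_simps sum_subtractf)
  have "(\<Sum>i\<le>n. c (n - i) * l (Suc i)) = (\<Sum>i\<le>Suc n. c (Suc n - i) * l i)"
    by (subst sum.atMost_Suc_shift) (simp add: l0)
  also have "\<dots> = (\<Sum>i\<le>n. c (Suc n - i) * l i) + l (Suc n)"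
    by (simp add: c_def)
  also have "\<dots> = (\<Sum>i\<le>n. c (n - i) * l i)"
    using rec by simp
  finally have "(\<Sum>i\<le>n. (l (Suc i) - l i) * c (n - i)) = 0"
    by (simp add: algebra_simps sum_subtractf)
  then show ?thesis
    by (simp add: l_def c_def)
qed

lemma caputo_lambda_Suc_le:
  assumes "\<alpha> \<le> 1" and "n \<ge> 1"
  shows "caputo_lambda \<alpha> (Suc n) \<le> caputo_lambda \<alpha> n"
proof -
  have "caputo_lambda \<alpha> (Suc n) - caputo_lambda \<alpha> n \<le> 0"
  proof (rule Kaluza[where c = "\<lambda>m. real (m + 1) powr (\<alpha> - 1)"
                     and d = "\<lambda>i. caputo_lambda \<alpha> (Suc i) - caputo_lambda \<alpha> i"])
    show "(real (Suc m + 1) powr (\<alpha> - 1))\<^sup>2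
            \<le> real (m + 1) powr (\<alpha> - 1) * real (Suc (Suc m) + 1) powr (\<alpha> - 1)" for m
      using powr_logconvex_nat[of "\<alpha> - 1" m] assms by (simp add: add.commute)
  qed (use assms caputo_lambda_diff_convolution in auto)
  then show ?thesis
    by simp
qed

text \<open>
  Summation by parts in inequality form: for nondecreasing nonnegative weights \<open>a\<close>, the omitted
  terms \<open>a\<^sub>0 g\<^sub>0\<close> and \<open>(a\<^sub>j - a\<^sub>j\<^sub>-\<^sub>1) g\<^sub>j\<close> are nonnegative, and only the upper boundary term
  remains.
\<close>

lemma sum_by_parts_lower_bound:
  fixes a g :: "nat \<Rightarrow> real"
  assumes "0 \<le> a 0" and g: "\<And>j. 0 \<le> g j"
    and "\<And>j. j < n \<Longrightarrow> a j \<le> a (Suc j)"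
  shows "- (a n * g (Suc n)) \<le> (\<Sum>j\<le>n. a j * (g j - g (Suc j)))"
  using assms(3)
proof (induction n)
  case 0
  then show ?case
    using assms(1) g[of 0] by (simp add: algebra_simps)
next
  case (Suc n)
  have "a n * g (Suc n) \<le> a (Suc n) * g (Suc n)"
    using Suc.prems[of n] g by (simp add: mult_right_mono)
  then show ?case
    using Suc by (simp add: algebra_simps)
qed

theorem lemma2:
  fixes \<alpha> \<tau> :: real and f :: "nat \<Rightarrow> real" and k :: nat
  assumes "0 < \<alpha>" and "\<alpha> \<le> 1" and "\<tau> > 0" and "k \<ge> 1"
  shows "f k * discrete_caputo \<alpha> \<tau> f k \<ge> 1 / 2 * discrete_caputo \<alpha> \<tau> (\<lambda>j. (f j)\<^sup>2) k"
proof -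
  define w where "w j = caputo_lambda \<alpha> (k - j)" for j
  define g where "g j = (f k - f j)\<^sup>2" for j
  obtain n where n: "k = Suc n"
    using assms(4) by (cases k) auto
  have w_mono: "w j \<le> w (Suc j)" if "j < n" for j
    using that caputo_lambda_Suc_le[OF assms(2), of "n - j"]
    by (simp add: w_def n Suc_diff_le del: caputo_lambda.simps)
  have "- (w n * g (Suc n)) \<le> (\<Sum>j\<le>n. w j * (g j - g (Suc j)))"
    by (rule sum_by_parts_lower_bound)
       (use w_mono caputo_lambda_nonneg[OF assms(2)] in \<open>auto simp: w_def g_def\<close>)
  then have nonneg: "0 \<le> (\<Sum>j<k. w j * (g j - g (Suc j)))"
    by (simp add: g_def n lessThan_Suc_atMost)
  have "(\<Sum>j<k. w j * (g j - g (Suc j)))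
          = (\<Sum>j<k. 2 * (f k * (w j * (f (j + 1) - f j)))
                     - w j * ((f (j + 1))\<^sup>2 - (f j)\<^sup>2))"
    by (rule sum.cong) (simp_all add: g_def power2_eq_square algebra_simps)
  also have "\<dots> = 2 * (f k * (\<Sum>j<k. w j * (f (j + 1) - f j)))
                   - (\<Sum>j<k. w j * ((f (j + 1))\<^sup>2 - (f j)\<^sup>2))"
    by (simp only: sum_subtractf sum_distrib_left)
  finally have "1 / 2 * (\<Sum>j<k. w j * ((f (j + 1))\<^sup>2 - (f j)\<^sup>2))
                  \<le> f k * (\<Sum>j<k. w j * (f (j + 1) - f j))"
    using nonneg by linarith
  moreover have "0 \<le> Gamma \<alpha> * \<tau> powr (- \<alpha>)"
    using Gamma_real_pos[OF assms(1)] by simp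
  ultimately have "Gamma \<alpha> * \<tau> powr (- \<alpha>)
                     * (1 / 2 * (\<Sum>j<k. w j * ((f (j + 1))\<^sup>2 - (f j)\<^sup>2)))
                   \<le> Gamma \<alpha> * \<tau> powr (- \<alpha>) * (f k * (\<Sum>j<k. w j * (f (j + 1) - f j)))"
    by (rule mult_left_mono)
  then show ?thesis
    unfolding discrete_caputo_def w_def by (simp only: mult.left_commute mult.assoc)
qed

end
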